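(* Let $a<b$ be real numbers and let $f:[a,b]\to\mathbb{R}$ be a convex function on $[a,b]$. Then for any $x\in[a,b]$ we have $$(x-a)f(a)+(b-x)f(b)-\int_a^b f(t)\,dt\le \frac12\left[(b-x)^2 f'_-(b)-(x-a)^2 f'_+(a)\right].$$ The constant $\frac12$ is sharp in the sense that it cannot be replaced by a smaller constant: if $D>0$ is a constant such that $(x-a)f(a)+(b-x)f(b)-\int_a^b f(t)\,dt\le D\left[(b-x)^2 f'_-(b)-(x-a)^2 f'_+(a)\right]$ for every convex $f:[a,b]\to\mathbb{R}$ and every $x\in[a,b]$, then $D\ge\frac12$.
   Context: $f'_+(a)=\lim_{h\to0^+}\frac{f(a+h)-f(a)}{h}\in[-\infty,\infty)$ and $f'_-(b)=\lim_{h\to0^+}\frac{f(b)-f(b-h)}{h}\in(-\infty,+\infty]$ are the one-sided derivatives at the endpoints; they may be infinite, in which case the right-hand side is read in the extended reals, with the convention $0\cdot(\pm\infty)=0$. *)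

theory Defs
  imports "HOL-Analysis.Analysis"
begin

definition right_deriv :: "(real \<Rightarrow> real) \<Rightarrow> real \<Rightarrow> ereal"
  where "right_deriv f a = Lim (at_right 0) (\<lambda>h. ereal ((f (a + h) - f a) / h))"

definition left_deriv :: "(real \<Rightarrow> real) \<Rightarrow> real \<Rightarrow> ereal"
  where "left_deriv f b = Lim (at_right 0) (\<lambda>h. ereal ((f b - f (b - h)) / h))"

text \<open>
  \<^const>\<open>Lim\<close> is a meaningful value only where the limit exists. The lemmas below show that
  it does at the endpoints for a convex function on a compact interval, and that the ranges
  are \<open>[-\<infinity>, \<infinity>)\<close> and \<open>(-\<infinity>, \<infinity>]\<close>, so that no difference \<open>\<infinity> - \<infinity>\<close> can arise.
  The convention \<open>0 \<cdot> (\<plusminus>\<infinity>) = 0\<close> is the one built into multiplication on \<^typ>\<open>ereal\<close>.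
\<close>

lemma tendsto_INF_at_right_0:
  fixes q :: "real \<Rightarrow> ereal"
  assumes "L > 0" and mono: "\<And>h k. 0 < h \<Longrightarrow> h \<le> k \<Longrightarrow> k \<le> L \<Longrightarrow> q h \<le> q k"
  shows "(q \<longlongrightarrow> (INF h\<in>{0<..L}. q h)) (at_right 0)"
proof (rule order_tendstoI)
  fix y assume "y < (INF h\<in>{0<..L}. q h)"
  then have "y < q h" if "0 < h" "h < L" for h
    using that by (metis INF_lower greaterThanAtMost_iff less_imp_le order_less_le_trans)
  then show "\<forall>\<^sub>F h in at_right 0. y < q h"
    using \<open>L > 0\<close> by (auto simp: eventually_at_right_field)
next
  fix y assume "(INF h\<in>{0<..L}. q h) < y"
  then obtain k where k: "0 < k" "k \<le> L" "q k < y"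
    by (auto simp: INF_less_iff)
  then have "q h < y" if "0 < h" "h < k" for h
    using that mono[of h k] by (meson less_imp_le order_le_less_trans)
  then show "\<forall>\<^sub>F h in at_right 0. q h < y"
    using k by (auto simp: eventually_at_right_field)
qed

lemma convex_on_chord:
  fixes f :: "real \<Rightarrow> real"
  assumes "convex_on S f" "x \<in> S" "y \<in> S" "0 < h" "h \<le> k"
    "y = x + k \<or> y = x - k" "z = x + (h / k) * (y - x)"
  shows "(f z - f x) / h \<le> (f y - f x) / k"
proof -
  have "f ((1 - h / k) *\<^sub>R x + (h / k) *\<^sub>R y) \<le> (1 - h / k) * f x + (h / k) * f y"
    using assms by (intro convex_onD) auto
  moreover have "(1 - h / k) *\<^sub>R x + (h / k) *\<^sub>R y = z"
    using assms by (simp add: algebra_simps diff_divide_distrib)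
  ultimately have "f z - f x \<le> (h / k) * (f y - f x)"
    by (simp add: algebra_simps)
  then show ?thesis
    using assms(4,5) by (simp add: divide_simps mult.commute)
qed

lemma right_deriv_convex:
  fixes f :: "real \<Rightarrow> real"
  assumes "a < b" "convex_on {a..b} f"
  shows "((\<lambda>h. ereal ((f (a + h) - f a) / h)) \<longlongrightarrow> right_deriv f a) (at_right 0)"
    and "right_deriv f a < \<infinity>"
proof -
  define q where "q = (\<lambda>h. ereal ((f (a + h) - f a) / h))"
  have "q h \<le> q k" if "0 < h" "h \<le> k" "k \<le> b - a" for h k
    unfolding q_def using that assms
    by (auto intro!: convex_on_chord[where y = "a + k" and S = "{a..b}"])
  then have *: "(q \<longlongrightarrow> (INF h\<in>{0<..b - a}. q h)) (at_right 0)"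
    using assms by (intro tendsto_INF_at_right_0) auto
  then have eq: "right_deriv f a = (INF h\<in>{0<..b - a}. q h)"
    unfolding right_deriv_def q_def by (intro tendsto_Lim) auto
  show "((\<lambda>h. ereal ((f (a + h) - f a) / h)) \<longlongrightarrow> right_deriv f a) (at_right 0)"
    using * unfolding eq by (simp add: q_def)
  have "(INF h\<in>{0<..b - a}. q h) \<le> q (b - a)"
    using assms by (intro INF_lower) auto
  also have "\<dots> < \<infinity>" by (simp add: q_def)
  finally show "right_deriv f a < \<infinity>" unfolding eq .
qed

lemma left_deriv_convex:
  fixes f :: "real \<Rightarrow> real"
  assumes "a < b" "convex_on {a..b} f"
  shows "((\<lambda>h. ereal ((f b - f (b - h)) / h)) \<longlongrightarrow> left_deriv f b) (at_right 0)"
    and "left_deriv f b > -\<infinity>"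
proof -
  define q where "q = (\<lambda>h. ereal ((f (b - h) - f b) / h))"
  have q: "(\<lambda>h. ereal ((f b - f (b - h)) / h)) = (\<lambda>h. - q h)"
    by (auto simp: q_def minus_divide_left)
  have "q h \<le> q k" if "0 < h" "h \<le> k" "k \<le> b - a" for h k
    unfolding q_def using that assms
    by (auto intro!: convex_on_chord[where y = "b - k" and S = "{a..b}"])
  then have "(q \<longlongrightarrow> (INF h\<in>{0<..b - a}. q h)) (at_right 0)"
    using assms by (intro tendsto_INF_at_right_0) auto
  then have *: "((\<lambda>h. - q h) \<longlongrightarrow> - (INF h\<in>{0<..b - a}. q h)) (at_right 0)"
    by (rule tendsto_uminus_ereal)
  then have eq: "left_deriv f b = - (INF h\<in>{0<..b - a}. q h)"
    unfolding left_deriv_def q by (intro tendsto_Lim) auto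
  show "((\<lambda>h. ereal ((f b - f (b - h)) / h)) \<longlongrightarrow> left_deriv f b) (at_right 0)"
    using * unfolding eq q .
  have "(INF h\<in>{0<..b - a}. q h) \<le> q (b - a)"
    using assms by (intro INF_lower) auto
  also have "\<dots> < \<infinity>" by (simp add: q_def)
  finally show "left_deriv f b > -\<infinity>"
    unfolding eq by (simp add: ereal_less_uminus_reorder)
qed

end

theory Submission
  imports Defs
begin

text \<open>
  A convex \<open>f\<close> lies above its one-sided tangents at both endpoints. Integrating the tangent at \<open>a\<close>
  over \<open>[a, x]\<close> and the tangent at \<open>b\<close> over \<open>[x, b]\<close> and adding gives the inequality; for the
  identity function and \<open>x = a\<close> it is an equality, so \<open>1/2\<close> is sharp.
\<close>

text \<open>A convex function may jump at the endpoints, so continuity is available only on the open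
  interval. There it gives measurability, and boundedness then gives integrability; the two
  endpoints do not affect the integral.\<close>

lemma convex_on_real_interval_integrable:
  fixes f :: "real \<Rightarrow> real"
  assumes cvx: "convex_on {a..b} f"
  shows "f integrable_on {a..b}"
proof -
  define M where "M = max (f a) (f b)"
  define m where "m = (a + b) / 2"
  have upper: "f t \<le> M" if "t \<in> {a..b}" for t
  proof -
    \<comment> \<open>The point \<open>t\<close> supplies \<open>a \<le> b\<close>; otherwise the
      interval would be empty while the hull is not.\<close>
    have "convex hull {a, b} = {a..b}"
      using that by (simp add: segment_convex_hull[symmetric] closed_segment_eq_real_ivl)
    then show ?thesis
      using convex_on_convex_hull_bound[of "{a, b}" f M] cvx that by (auto simp: M_def)
  qed
  have lower: "2 * f m - M \<le> f t" if t: "t \<in> {a..b}" for t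
  proof -
    \<comment> \<open>Reflection in the midpoint: \<open>2 * f m \<le> f t + f (a + b - t)\<close>,
      and the last term is at most \<open>M\<close>.\<close>
    have refl: "a + b - t \<in> {a..b}" using t by auto
    have "f ((1 - 1/2) *\<^sub>R t + (1/2) *\<^sub>R (a + b - t)) \<le> (1 - 1/2) * f t + (1/2) * f (a + b - t)"
      using t refl cvx by (intro convex_onD) auto
    moreover have "(1 - 1/2) *\<^sub>R t + (1/2) *\<^sub>R (a + b - t) = m"
      by (simp add: m_def field_simps)
    ultimately show ?thesis using upper[OF refl] by simp
  qed
  have "continuous_on {a<..<b} f"
    by (intro convex_on_continuous convex_on_subset[OF cvx]) auto
  then have "f \<in> borel_measurable (lebesgue_on {a<..<b})"
    by (intro continuous_imp_measurable_on_sets_lebesgue) auto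
  then have "f integrable_on {a<..<b}"
  proof (rule measurable_bounded_by_integrable_imp_integrable)
    show "(\<lambda>_. \<bar>M\<bar> + \<bar>2 * f m - M\<bar>) integrable_on {a<..<b}"
      unfolding integrable_on_open_interval_real by (rule integrable_const_ivl)
    show "norm (f t) \<le> \<bar>M\<bar> + \<bar>2 * f m - M\<bar>" if "t \<in> {a<..<b}" for t
      using upper[of t] lower[of t] that by auto
  qed auto
  then show ?thesis by (simp add: integrable_on_open_interval_real)
qed

text \<open>Difference quotients at \<open>a\<close> grow with the step, so their limit as the step
  shrinks stays below each of them, even when it is \<open>-\<infinity>\<close>.\<close>

lemma right_deriv_le_chord:
  fixes f :: "real \<Rightarrow> real"
  assumes cvx: "convex_on {a..b} f" and t: "a < t" "t \<le> b"
  shows "right_deriv f a \<le> ereal ((f t - f a) / (t - a))"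
proof (rule tendsto_upperbound)
  show "((\<lambda>h. ereal ((f (a + h) - f a) / h)) \<longlongrightarrow> right_deriv f a) (at_right 0)"
    using t by (intro right_deriv_convex(1)[OF _ cvx]) simp
  have "(f (a + h) - f a) / h \<le> (f t - f a) / (t - a)" if "0 < h" "h < t - a" for h
    using that t by (intro convex_on_chord[OF cvx, where y = t]) auto
  then show "\<forall>\<^sub>F h in at_right 0. ereal ((f (a + h) - f a) / h) \<le> ereal ((f t - f a) / (t - a))"
    using t by (auto simp: eventually_at_right_field intro!: exI[of _ "t - a"])
qed simp

lemma chord_le_left_deriv:
  fixes f :: "real \<Rightarrow> real"
  assumes cvx: "convex_on {a..b} f" and t: "a \<le> t" "t < b"
  shows "ereal ((f b - f t) / (b - t)) \<le> left_deriv f b"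
proof (rule tendsto_lowerbound)
  show "((\<lambda>h. ereal ((f b - f (b - h)) / h)) \<longlongrightarrow> left_deriv f b) (at_right 0)"
    using t by (intro left_deriv_convex(1)[OF _ cvx]) simp
  have "(f b - f t) / (b - t) \<le> (f b - f (b - h)) / h" if "0 < h" "h < b - t" for h
  proof -
    \<comment> \<open>The backward case of \<open>convex_on_chord\<close>, based at
      \<open>b\<close>; negating both quotients reverses the inequality.\<close>
    have "(f (b - h) - f b) / h \<le> (f t - f b) / (b - t)"
      using that t by (intro convex_on_chord[OF cvx, where y = t]) (auto simp: field_simps)
    then show ?thesis by (simp add: diff_divide_distrib)
  qed
  then show "\<forall>\<^sub>F h in at_right 0. ereal ((f b - f t) / (b - t)) \<le> ereal ((f b - f (b - h)) / h)"
    using t by (auto simp: eventually_at_right_field intro!: exI[of _ "b - t"])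
qed simp

text \<open>The antiderivative is \<open>c * t + r * (t - s)\<^sup>2 / 2\<close>. Centring at
  \<open>s\<close> makes one of the squares vanish when \<open>s\<close> is the endpoint of
  tangency.\<close>

lemma has_integral_affine:
  fixes c r p q :: real
  assumes "p \<le> q"
  shows "((\<lambda>t. c + r * (t - s)) has_integral
    (c * (q - p) + r * ((q - s)\<^sup>2 - (p - s)\<^sup>2) / 2)) {p..q}"
proof -
  have "((\<lambda>t. c + r * (t - s)) has_integral
      (c * q + r * (q - s)\<^sup>2 / 2) - (c * p + r * (p - s)\<^sup>2 / 2)) {p..q}"
    using assms
    by (intro fundamental_theorem_of_calculus)
      (auto intro!: derivative_eq_intros simp flip: has_real_derivative_iff_has_vector_derivative)
  then show ?thesis by (simp add: algebra_simps diff_divide_distrib)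
qed

lemma integral_ge_right_tangent:
  fixes f :: "real \<Rightarrow> real"
  assumes "a < b" and cvx: "convex_on {a..b} f" and x: "x \<in> {a..b}"
  shows "ereal ((x - a) * f a - integral {a..x} f)
    \<le> ereal (1 / 2) * - (ereal ((x - a)\<^sup>2) * right_deriv f a)"
proof (cases "right_deriv f a")
  case (real r)
  \<comment> \<open>The tangent lies below the graph: clear the denominator in the chord bound,
    which needs \<open>t \<noteq> a\<close>.\<close>
  have "f a + r * (t - a) \<le> f t" if "t \<in> {a..x}" for t
  proof (cases "t = a")
    case False
    then show ?thesis
      using right_deriv_le_chord[OF cvx, of t] that x real by (auto simp: field_simps)
  qed simp
  moreover have "f integrable_on {a..x}"
    using convex_on_real_interval_integrable[OF cvx] x by (auto intro: integrable_subinterval_real)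
  ultimately have "f a * (x - a) + r * ((x - a)\<^sup>2 - (a - a)\<^sup>2) / 2 \<le> integral {a..x} f"
    using x by (intro has_integral_le[OF has_integral_affine integrable_integral]) auto
  then show ?thesis by (simp add: real mult.commute)
next
  case MInf
  \<comment> \<open>For \<open>x > a\<close> the right side is \<open>\<infinity>\<close>. For
    \<open>x = a\<close> the convention \<open>0 * (-\<infinity>) = 0\<close> makes both sides
    0.\<close>
  then show ?thesis using x by (cases "x = a") (auto simp: zero_ereal_def[symmetric])
next
  case PInf
  then show ?thesis using right_deriv_convex(2)[OF \<open>a < b\<close> cvx] by simp
qed

text \<open>Mirror image at \<open>b\<close>: there \<open>t - b \<le> 0\<close>, so the slope
  enters the bound with a plus sign.\<close>

lemma integral_ge_left_tangent:
  fixes f :: "real \<Rightarrow> real"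
  assumes "a < b" and cvx: "convex_on {a..b} f" and x: "x \<in> {a..b}"
  shows "ereal ((b - x) * f b - integral {x..b} f)
    \<le> ereal (1 / 2) * (ereal ((b - x)\<^sup>2) * left_deriv f b)"
proof (cases "left_deriv f b")
  case (real r)
  have "f b + r * (t - b) \<le> f t" if "t \<in> {x..b}" for t
  proof (cases "t = b")
    case False
    then show ?thesis
      using chord_le_left_deriv[OF cvx, of t] that x real by (auto simp: field_simps)
  qed simp
  moreover have "f integrable_on {x..b}"
    using convex_on_real_interval_integrable[OF cvx] x by (auto intro: integrable_subinterval_real)
  ultimately have "f b * (b - x) + r * ((b - b)\<^sup>2 - (x - b)\<^sup>2) / 2 \<le> integral {x..b} f"
    using x by (intro has_integral_le[OF has_integral_affine integrable_integral]) auto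
  then show ?thesis by (simp add: real mult.commute power2_commute)
next
  case PInf
  then show ?thesis using x by (cases "x = b") (auto simp: zero_ereal_def[symmetric])
next
  case MInf
  then show ?thesis using left_deriv_convex(2)[OF \<open>a < b\<close> cvx] by simp
qed

lemma left_deriv_ident: "left_deriv (\<lambda>t. t) b = 1"
  unfolding left_deriv_def
proof (rule tendsto_Lim)
  have "\<forall>\<^sub>F h in at_right 0. ereal ((b - (b - h)) / h) = 1"
    by (auto simp: eventually_at_right_field one_ereal_def intro!: exI[of _ 1])
  then show "((\<lambda>h. ereal ((b - (b - h)) / h)) \<longlongrightarrow> 1) (at_right 0)"
    by (rule tendsto_eventually)
qed simp

theorem theorem6:
  fixes a b :: real
  assumes "a < b"
  shows "(\<forall>f :: real \<Rightarrow> real. convex_on {a..b} f \<longrightarrow> (\<forall>x\<in>{a..b}.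
            ereal ((x - a) * f a + (b - x) * f b - integral {a..b} f)
              \<le> ereal (1 / 2) * (ereal ((b - x)\<^sup>2) * left_deriv f b
                                  - ereal ((x - a)\<^sup>2) * right_deriv f a))) \<and>
         (\<forall>D :: real. D > 0 \<longrightarrow>
            (\<forall>f :: real \<Rightarrow> real. convex_on {a..b} f \<longrightarrow> (\<forall>x\<in>{a..b}.
              ereal ((x - a) * f a + (b - x) * f b - integral {a..b} f)
                \<le> ereal D * (ereal ((b - x)\<^sup>2) * left_deriv f b
                              - ereal ((x - a)\<^sup>2) * right_deriv f a)))
            \<longrightarrow> D \<ge> 1 / 2)"
proof (intro conjI allI impI ballI)
  fix f :: "real \<Rightarrow> real" and x
  assume cvx: "convex_on {a..b} f" and x: "x \<in> {a..b}"
  have "integral {a..x} f + integral {x..b} f = integral {a..b} f"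
    using x convex_on_real_interval_integrable[OF cvx]
    by (intro Henstock_Kurzweil_Integration.integral_combine) auto
  then have "ereal ((x - a) * f a + (b - x) * f b - integral {a..b} f)
    = ereal ((b - x) * f b - integral {x..b} f) + ereal ((x - a) * f a - integral {a..x} f)"
    by simp
  also have "\<dots> \<le> ereal (1 / 2) * (ereal ((b - x)\<^sup>2) * left_deriv f b)
    + ereal (1 / 2) * - (ereal ((x - a)\<^sup>2) * right_deriv f a)"
    by (intro add_mono integral_ge_left_tangent[OF assms cvx x]
      integral_ge_right_tangent[OF assms cvx x])
  also have "\<dots> = ereal (1 / 2) * (ereal ((b - x)\<^sup>2) * left_deriv f b
    - ereal ((x - a)\<^sup>2) * right_deriv f a)"
    \<comment> \<open>Distributivity can fail in \<open>ereal\<close>, but it holds for a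
      nonnegative finite factor such as \<open>1 / 2\<close>.\<close>
    unfolding minus_ereal_def by (rule ereal_pos_distrib[symmetric]) auto
  finally show "ereal ((x - a) * f a + (b - x) * f b - integral {a..b} f)
    \<le> ereal (1 / 2) * (ereal ((b - x)\<^sup>2) * left_deriv f b
      - ereal ((x - a)\<^sup>2) * right_deriv f a)" .
next
  fix D :: real
  assume "\<forall>f :: real \<Rightarrow> real. convex_on {a..b} f \<longrightarrow> (\<forall>x\<in>{a..b}.
    ereal ((x - a) * f a + (b - x) * f b - integral {a..b} f)
      \<le> ereal D * (ereal ((b - x)\<^sup>2) * left_deriv f b - ereal ((x - a)\<^sup>2) * right_deriv f a))"
  moreover have "convex_on {a..b} (\<lambda>t. t)"
    by (simp add: convex_on_def)
  ultimately have "ereal ((a - a) * a + (b - a) * b - integral {a..b} (\<lambda>t. t))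
    \<le> ereal D * (ereal ((b - a)\<^sup>2) * left_deriv (\<lambda>t. t) b
      - ereal ((a - a)\<^sup>2) * right_deriv (\<lambda>t. t) a)"
    using assms by force
  \<comment> \<open>At \<open>x = a\<close> the factor 0 removes the right derivative, whatever its
    value, and the left derivative is 1, so the inequality becomes one between reals.\<close>
  then have "(b - a) * b - integral {a..b} (\<lambda>t. t) \<le> D * (b - a)\<^sup>2"
    by (simp add: left_deriv_ident zero_ereal_def[symmetric])
  moreover have "integral {a..b} (\<lambda>t. t) = (b\<^sup>2 - a\<^sup>2) / 2"
    using has_integral_affine[of a b 0 1 0] assms by (auto intro: integral_unique)
  moreover have "(b - a) * b - (b\<^sup>2 - a\<^sup>2) / 2 = 1 / 2 * (b - a)\<^sup>2"
    by (simp add: power2_eq_square field_simps)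
  ultimately have "1 / 2 * (b - a)\<^sup>2 \<le> D * (b - a)\<^sup>2"
    by simp
  \<comment> \<open>Cancel \<open>(b - a)\<^sup>2\<close>, which is positive since
    \<open>a < b\<close>.\<close>
  then show "D \<ge> 1 / 2"
    using assms by (subst (asm) mult_le_cancel_right_pos) auto
qed

end
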